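(* Consider the single load minimal cache demand problem with $c$ cores and total cache $K$. Let algorithm $A_2$ be: sort the jobs in non-increasing order of cache demand $x_j$; assign them in this order to cores $1,2,\dots$, continuing to assign jobs to the current core until its total load exceeds $1$, then moving to the next core; allocate to each core the cache demand of the first (most demanding) job assigned to it; fail if more than $c$ cores or more than $K$ cache are used. If there is a cache partition and job assignment of makespan at most $1$ that use $c$ cores and $K$ cache, then $A_2$ finds a cache partition and job assignment of makespan at most $2$ that use at most $c$ cores and at most $K$ cache.
   Context: Single load minimal cache demand problem: each job $j$ has a load $a_j>0$ and a minimal cache demand $x_j\ge0$. A solution is a cache partition $p$ giving $p(i)\ge0$ cache to each of the $c$ cores with $\sum_ip(i)\le K$ (this sum is the cache used), and an assignment $S$ of jobs to cores such that every job $j$ is assigned to a core with $p(S(j))\ge x_j$. The load of a core is the sum of $a_j$ over jobs assigned to it, and the makespan is the maximum load of a core. *)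

theory Defs
  imports Complex_Main
begin

text \<open>The cores are the numbers \<open>1, \<dots>, c\<close>; \<open>J\<close> is the set of jobs, \<open>a j\<close> and \<open>x j\<close> are the load and
  the minimal cache demand of job \<open>j\<close>.\<close>

definition cache_partition :: "nat \<Rightarrow> real \<Rightarrow> (nat \<Rightarrow> real) \<Rightarrow> bool" where
  "cache_partition c K p \<longleftrightarrow> (\<forall>i\<in>{1..c}. 0 \<le> p i) \<and> (\<Sum>i=1..c. p i) \<le> K"

definition job_assignment ::
  "'j set \<Rightarrow> ('j \<Rightarrow> real) \<Rightarrow> nat \<Rightarrow> (nat \<Rightarrow> real) \<Rightarrow> ('j \<Rightarrow> nat) \<Rightarrow> bool" where
  "job_assignment J x c p S \<longleftrightarrow> (\<forall>j\<in>J. S j \<in> {1..c} \<and> x j \<le> p (S j))"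

definition solution ::
  "'j set \<Rightarrow> ('j \<Rightarrow> real) \<Rightarrow> nat \<Rightarrow> real \<Rightarrow> (nat \<Rightarrow> real) \<Rightarrow> ('j \<Rightarrow> nat) \<Rightarrow> bool" where
  "solution J x c K p S \<longleftrightarrow> cache_partition c K p \<and> job_assignment J x c p S"

definition core_load :: "'j set \<Rightarrow> ('j \<Rightarrow> real) \<Rightarrow> ('j \<Rightarrow> nat) \<Rightarrow> nat \<Rightarrow> real" where
  "core_load J a S i = (\<Sum>j\<in>{j \<in> J. S j = i}. a j)"

text \<open>For \<open>c = 0\<close> this is the unspecified \<open>Max {}\<close>, the same value for all job assignments.\<close>

definition makespan :: "'j set \<Rightarrow> ('j \<Rightarrow> real) \<Rightarrow> nat \<Rightarrow> ('j \<Rightarrow> nat) \<Rightarrow> real" where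
  "makespan J a c S = Max (core_load J a S ` {1..c})"

text \<open>\<open>fill_cores a cur js\<close> distributes the jobs \<open>js\<close> in the given order, where \<open>cur\<close> are the jobs
  already on the current core. The result lists the jobs of each used core. The job that
  makes the load exceed \<open>1\<close> stays on the current core, and a new core is opened only if a job
  remains, so all returned blocks are nonempty.\<close>

fun fill_cores :: "('j \<Rightarrow> real) \<Rightarrow> 'j list \<Rightarrow> 'j list \<Rightarrow> 'j list list" where
  "fill_cores a cur [] = (if cur = [] then [] else [cur])"
| "fill_cores a cur (j # js) =
     (if sum_list (map a (cur @ [j])) > 1
      then (cur @ [j]) # fill_cores a [] js
      else fill_cores a (cur @ [j]) js)"

text \<open>Core \<open>i\<close> holds the block with list index \<open>i - 1\<close>. Unused cores get no cache.\<close>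

definition block_partition :: "('j \<Rightarrow> real) \<Rightarrow> 'j list list \<Rightarrow> nat \<Rightarrow> real" where
  "block_partition x B i = (if i \<in> {1..length B} then x (hd (B ! (i - 1))) else 0)"

definition block_assignment :: "'j list list \<Rightarrow> 'j \<Rightarrow> nat" where
  "block_assignment B j = (THE i. i \<in> {1..length B} \<and> j \<in> set (B ! (i - 1)))"

text \<open>The input lists the jobs in arbitrary order. As \<open>sort_key\<close> is stable, every way of breaking
  ties between equal demands arises from some input order. The result \<open>None\<close> means failure.\<close>

definition A2 ::
  "('j \<Rightarrow> real) \<Rightarrow> ('j \<Rightarrow> real) \<Rightarrow> nat \<Rightarrow> real \<Rightarrow> 'j list
     \<Rightarrow> ((nat \<Rightarrow> real) \<times> ('j \<Rightarrow> nat)) option" where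
  "A2 a x c K js =
     (let B = fill_cores a [] (sort_key (\<lambda>j. - x j) js);
          p = block_partition x B;
          S = block_assignment B
      in if length B > c \<or> (\<Sum>i=1..length B. p i) > K then None else Some (p, S))"

end

theory Submission
  imports Defs
begin

text \<open>Every block of \<open>A2\<close> except the last has load more than \<open>1\<close>. The jobs of the first \<open>k\<close> blocks
  together with the first job \<open>h\<close> of the next one have load more than \<open>k\<close> and demand at least \<open>x h\<close>,
  so a solution of makespan at most \<open>1\<close> has more than \<open>k\<close> cores with cache at least \<open>x h\<close>. Hence
  the demands of the heads of the blocks are matched greedily to distinct cores of that solution.
  A block has load at most \<open>1\<close> before its last job, which itself has load at most \<open>1\<close>.\<close>

lemma concat_fill_cores: "concat (fill_cores a cur js) = cur @ js"
  by (induction a cur js rule: fill_cores.induct) auto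

lemma Nil_notin_fill_cores: "[] \<notin> set (fill_cores a cur js)"
  by (induction a cur js rule: fill_cores.induct) auto

text \<open>A block is closed either by the test for load above 1 or by the end of the input, and
  the latter can produce only the last block.\<close>

lemma fill_cores_butlast_load:
  "b \<in> set (butlast (fill_cores a cur js)) \<Longrightarrow> sum_list (map a b) > 1"
  by (induction a cur js rule: fill_cores.induct) (auto split: if_splits)

text \<open>The bound on \<open>cur\<close> is the invariant of the recursion: a block that stays
  open has load at most 1, so the job that closes it lifts the load to at most 1 + 1, and the next
  block starts empty.\<close>

lemma fill_cores_load_le:
  assumes "sum_list (map a cur) \<le> 1" and "\<And>j. j \<in> set js \<Longrightarrow> a j \<le> 1"
    and "b \<in> set (fill_cores a cur js)"
  shows "sum_list (map a b) \<le> 2"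
  using assms
proof (induction a cur js rule: fill_cores.induct)
  case (2 a cur j js)
  have "a j \<le> 1"
    using "2.prems" by simp
  then show ?case
    using 2 by (fastforce split: if_splits)
qed (auto split: if_splits)

text \<open>Strictness is lost in the conclusion because \<open>B\<close> may be empty.\<close>

lemma sum_list_concat_gt:
  fixes a :: "'j \<Rightarrow> real"
  assumes "\<And>b. b \<in> set B \<Longrightarrow> sum_list (map a b) > 1"
  shows "sum_list (map a (concat B)) \<ge> length B"
  using assms by (induction B) fastforce+

text \<open>The first \<open>k\<close> blocks all lie in \<open>butlast B\<close>, so they carry
  load at least \<open>k\<close>; the positive load of \<open>h\<close> makes the bound strict, also
  for \<open>k = 0\<close>.\<close>

lemma load_prefix_gt:
  fixes a :: "'j \<Rightarrow> real"
  assumes "\<And>b. b \<in> set (butlast B) \<Longrightarrow> sum_list (map a b) > 1"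
    and "k < length B" and "a h > 0"
  shows "sum_list (map a (concat (take k B) @ [h])) > k"
proof -
  have "set (take k B) \<subseteq> set (butlast B)"
    using assms(2) by (simp add: butlast_conv_take set_take_subset_set_take)
  then have "sum_list (map a (concat (take k B))) \<ge> length (take k B)"
    using assms(1) by (intro sum_list_concat_gt) blast
  then show ?thesis
    using assms(2,3) by simp
qed

lemma concat_split_at:
  assumes "k < length B" and "B ! k \<noteq> []"
  shows "concat B = concat (take k B) @ hd (B ! k) # tl (B ! k) @ concat (drop (Suc k) B)"
  using arg_cong[OF id_take_nth_drop[OF assms(1)], of concat] assms(2) by simp

text \<open>Indices are chosen one at a time: when \<open>m\<close> are taken, more than
  \<open>m\<close> satisfy \<open>d m \<le> p i\<close>, so one of these is still free.\<close>

lemma greedy_subset: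
  fixes p d :: "nat \<Rightarrow> real"
  assumes "finite I" and "\<And>k. k < m \<Longrightarrow> k < card {i \<in> I. d k \<le> p i}"
  shows "\<exists>A\<subseteq>I. card A = m \<and> (\<Sum>k<m. d k) \<le> sum p A"
  using assms(2)
proof (induction m)
  case (Suc m)
  then obtain A where A: "A \<subseteq> I" "card A = m" "(\<Sum>k<m. d k) \<le> sum p A"
    by fastforce
  have "finite A"
    using A(1) assms(1) finite_subset by blast
  moreover have "card A < card {i \<in> I. d m \<le> p i}"
    using Suc.prems[of m] A(2) by simp
  ultimately obtain i where "i \<in> I" "d m \<le> p i" "i \<notin> A"
    using card_mono[of A "{i \<in> I. d m \<le> p i}"] by fastforce
  then show ?case
    using A \<open>finite A\<close> by (intro exI[of _ "insert i A"]) auto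
qed auto

text \<open>Jobs of demand at least \<open>d\<close> can sit only on cores with cache at least
  \<open>d\<close>, and each such core contributes load at most 1.\<close>

lemma load_le_card_cores:
  fixes a x :: "'j \<Rightarrow> real"
  assumes "finite J" and "\<And>j. j \<in> J \<Longrightarrow> a j \<ge> 0" and "job_assignment J x c p S"
    and "\<And>i. i \<in> {1..c} \<Longrightarrow> core_load J a S i \<le> 1"
    and "T \<subseteq> J" and "\<And>j. j \<in> T \<Longrightarrow> d \<le> x j"
  shows "sum a T \<le> card {i \<in> {1..c}. d \<le> p i}"
proof -
  let ?I = "{i \<in> {1..c}. d \<le> p i}"
  have "S ` T \<subseteq> ?I"
    using assms(3,5,6) unfolding job_assignment_def by fastforce
  then have "sum a T \<le> sum a {j \<in> J. S j \<in> ?I}"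
    using assms(1,2,5) by (intro sum_mono2) auto
  also have "\<dots> = (\<Sum>i\<in>?I. sum a {j \<in> {j \<in> J. S j \<in> ?I}. S j = i})"
    using assms(1) by (intro sum.group[symmetric]) auto
  also have "\<dots> = (\<Sum>i\<in>?I. core_load J a S i)"
    unfolding core_load_def by (intro sum.cong) auto
  also have "\<dots> \<le> card ?I"
    using sum_bounded_above[of ?I "core_load J a S" 1] assms(4) by simp
  finally show ?thesis .
qed

text \<open>By symmetry let \<open>k \<le> l\<close>. If \<open>k < l\<close>, then \<open>j\<close>
  would occur both in \<open>concat (take l B)\<close> and in the segment \<open>B ! l\<close> that
  follows it.\<close>

lemma distinct_concat_nth_unique:
  assumes "distinct (concat B)" and "k < length B" and "l < length B"
    and "j \<in> set (B ! k)" and "j \<in> set (B ! l)"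
  shows "k = l"
  using assms
proof (induction k l rule: linorder_wlog)
  case (le k l)
  show ?case
  proof (rule ccontr)
    assume "k \<noteq> l"
    then have "B ! k \<in> set (take l B)"
      using le by (auto simp: in_set_conv_nth intro!: exI[of _ k])
    then have "j \<in> set (concat (take l B))"
      using le by auto
    moreover have "concat B = concat (take l B) @ B ! l @ concat (drop (Suc l) B)"
      using arg_cong[OF id_take_nth_drop[of l B], of concat] le by simp
    ultimately show False
      using le by auto
  qed
qed simp

text \<open>Distinctness makes the definite description in \<open>block_assignment\<close> well
  defined; \<open>Suc\<close> shifts list indices to core numbers.\<close>

lemma block_assignment_eq:
  assumes "distinct (concat B)" and "k < length B" and "j \<in> set (B ! k)"
  shows "block_assignment B j = Suc k"
  unfolding block_assignment_def
proof (rule the_equality)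
  fix i assume "i \<in> {1..length B} \<and> j \<in> set (B ! (i - 1))"
  then show "i = Suc k"
    using distinct_concat_nth_unique[OF assms(1), of "i - 1" k j] assms(2,3) by auto
qed (use assms in auto)

lemma block_obtain:
  assumes "j \<in> set (concat B)"
  obtains k where "k < length B" "j \<in> set (B ! k)"
  using assms by (metis UN_E in_set_conv_nth set_concat)

lemma core_load_block_assignment:
  assumes "distinct (concat B)" and "i \<ge> 1"
  shows "core_load (set (concat B)) a (block_assignment B) i
    = (if i \<le> length B then sum_list (map a (B ! (i - 1))) else 0)"
proof -
  have *: "block_assignment B j = i \<longleftrightarrow> i \<le> length B \<and> j \<in> set (B ! (i - 1))"
    if j: "j \<in> set (concat B)" for j
  proof -
    obtain k where k: "k < length B" "j \<in> set (B ! k)"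
      using block_obtain j .
    then show ?thesis
      using block_assignment_eq[OF assms(1) k]
        distinct_concat_nth_unique[OF assms(1) k(1), of "i - 1" j] assms(2) by auto
  qed
  show ?thesis
  proof (cases "i \<le> length B")
    case True
    then have mem: "B ! (i - 1) \<in> set B"
      using assms(2) by simp
    have "{j \<in> set (concat B). block_assignment B j = i} = set (B ! (i - 1))"
      using * True mem by auto
    moreover have "distinct (B ! (i - 1))"
      using assms(1) mem by (simp add: distinct_concat_iff)
    ultimately show ?thesis
      using True unfolding core_load_def by (simp add: sum_list_distinct_conv_sum_set)
  next
    case False
    then have "{j \<in> set (concat B). block_assignment B j = i} = {}"
      using * by auto
    then show ?thesis
      using False unfolding core_load_def by (simp only: sum.empty if_False)
  qed
qed

lemma sum_block_partition:
  "(\<Sum>i=1..length B. block_partition x B i) = (\<Sum>k<length B. x (hd (B ! k)))"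
  by (simp add: block_partition_def sum.atLeast1_atMost_eq)

lemma sum_block_partition_le:
  assumes "length B \<le> c"
  shows "(\<Sum>i=1..c. block_partition x B i) = (\<Sum>i=1..length B. block_partition x B i)"
  using assms by (intro sum.mono_neutral_right) (auto simp: block_partition_def)

theorem theorem5:
  fixes a x :: "'j \<Rightarrow> real" and js :: "'j list" and c :: nat and K :: real
  assumes "distinct js"
    and "\<And>j. j \<in> set js \<Longrightarrow> a j > 0"
    and "\<And>j. j \<in> set js \<Longrightarrow> x j \<ge> 0"
    and "\<exists>p S. solution (set js) x c K p S \<and> makespan (set js) a c S \<le> 1"
  shows "\<exists>p S. A2 a x c K js = Some (p, S) \<and>
           solution (set js) x c K p S \<and> makespan (set js) a c S \<le> 2"
proof -
  obtain p S where sol: "solution (set js) x c K p S" and ms: "makespan (set js) a c S \<le> 1"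
    using assms(4) by blast
  have part: "cache_partition c K p" and asg: "job_assignment (set js) x c p S"
    using sol unfolding solution_def by auto
  have load: "core_load (set js) a S i \<le> 1" if "i \<in> {1..c}" for i
  proof -
    have "core_load (set js) a S i \<le> makespan (set js) a c S"
      unfolding makespan_def using that by (intro Max_ge) auto
    then show ?thesis
      using ms by simp
  qed
  have a_le: "a j \<le> 1" if j: "j \<in> set js" for j
  proof -
    have "a j \<le> core_load (set js) a S (S j)"
      unfolding core_load_def using j assms(2) by (intro member_le_sum) (auto intro: less_imp_le)
    also have "\<dots> \<le> 1"
      using load asg j unfolding job_assignment_def by blast
    finally show ?thesis .
  qed
  define zs where "zs = sort_key (\<lambda>j. - x j) js"
  define B where "B = fill_cores a [] zs"
  have set_zs: "set zs = set js" and dist: "distinct zs"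
    using assms(1) by (auto simp: zs_def)
  have sorted: "sorted_wrt (\<lambda>i j. x j \<le> x i) zs"
    using sorted_sort_key[of "\<lambda>j. - x j" js] by (simp add: zs_def sorted_map)
  have concat_B: "concat B = zs"
    by (simp add: B_def concat_fill_cores)
  \<comment> \<open>Only for nonempty blocks does \<open>hd\<close> denote a job.\<close>
  have ne: "B ! k \<noteq> []" if "k < length B" for k
    using that Nil_notin_fill_cores[of a "[]" zs] nth_mem[OF that] unfolding B_def by metis
  have split: "zs = concat (take k B) @ hd (B ! k) # tl (B ! k) @ concat (drop (Suc k) B)"
    if "k < length B" for k
    using concat_split_at[OF that ne[OF that]] concat_B by simp
  have many_cores: "k < card {i \<in> {1..c}. x (hd (B ! k)) \<le> p i}" if k: "k < length B" for k
  proof -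
    let ?h = "hd (B ! k)"
    \<comment> \<open>This is the initial segment of \<open>zs\<close> that ends with
      \<open>?h\<close>, so by the sorting each of its jobs demands at least
      \<open>x ?h\<close>.\<close>
    let ?T = "concat (take k B) @ [?h]"
    have T: "set ?T \<subseteq> set js" "distinct ?T"
      using split[OF k] set_zs dist by (metis append.assoc append_Cons append_Nil
          distinct_append set_append sup_ge1)+
    have dem: "x ?h \<le> x j" if "j \<in> set ?T" for j
    proof -
      have "sorted_wrt (\<lambda>i j. x j \<le> x i) (concat (take k B) @ ?h # tl (B ! k) @ concat (drop (Suc k) B))"
        using sorted split[OF k] by simp
      then show ?thesis
        using that unfolding sorted_wrt_append by auto
    qed
    have "real k < sum_list (map a ?T)"
      using k T(1) assms(2)
      by (intro load_prefix_gt) (auto simp: B_def dest: fill_cores_butlast_load)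
    also have "\<dots> = sum a (set ?T)"
      using T(2) by (rule sum_list_distinct_conv_sum_set)
    also have "\<dots> \<le> card {i \<in> {1..c}. x ?h \<le> p i}"
      using T(1) dem asg load assms(2)
      by (intro load_le_card_cores[where J = "set js" and S = S and x = x]) (auto intro: less_imp_le)
    finally show ?thesis
      by simp
  qed
  \<comment> \<open>The set \<open>A\<close> of cores of the given solution yields both resource
    bounds: its size bounds the number of blocks, its cache the total demand of their heads.\<close>
  obtain A where A: "A \<subseteq> {1..c}" "card A = length B" "(\<Sum>k<length B. x (hd (B ! k))) \<le> sum p A"
    using greedy_subset[of "{1..c}" "length B" "\<lambda>k. x (hd (B ! k))" p] many_cores by auto
  have len: "length B \<le> c"
    using card_mono[OF _ A(1)] A(2) by simp
  have "sum p A \<le> sum p {1..c}"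
    using A(1) part unfolding cache_partition_def by (intro sum_mono2) auto
  then have cache: "(\<Sum>i=1..length B. block_partition x B i) \<le> K"
    using A(3) part unfolding cache_partition_def sum_block_partition by linarith
  have A2: "A2 a x c K js = Some (block_partition x B, block_assignment B)"
    using len cache unfolding A2_def Let_def B_def[symmetric] zs_def[symmetric] by simp
  have "x (hd (B ! k)) \<ge> 0" if "k < length B" for k
    using split[OF that] set_zs assms(3) by (metis in_set_conv_decomp)
  then have "block_partition x B i \<ge> 0" for i
    by (auto simp: block_partition_def)
  then have "cache_partition c K (block_partition x B)"
    using cache unfolding cache_partition_def sum_block_partition_le[OF len] by blast
  moreover have "job_assignment (set js) x c (block_partition x B) (block_assignment B)"
    unfolding job_assignment_def
  proof
    fix j assume "j \<in> set js"
    then obtain k where k: "k < length B" "j \<in> set (B ! k)"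
      using block_obtain concat_B set_zs by metis
    \<comment> \<open>Jobs in the tail come after the head in \<open>zs\<close>, hence demand no
      more than it.\<close>
    have "j = hd (B ! k) \<or> j \<in> set (tl (B ! k))"
      using k(2) ne[OF k(1)] by (metis list.collapse set_ConsD)
    moreover have "sorted_wrt (\<lambda>i j. x j \<le> x i)
        (concat (take k B) @ hd (B ! k) # tl (B ! k) @ concat (drop (Suc k) B))"
      using sorted split[OF k(1)] by simp
    ultimately have "x j \<le> x (hd (B ! k))"
      by (auto simp: sorted_wrt_append)
    then show "block_assignment B j \<in> {1..c} \<and> x j \<le> block_partition x B (block_assignment B j)"
      using k len block_assignment_eq[OF _ k] dist concat_B by (simp add: block_partition_def)
  qed
  ultimately have sol': "solution (set js) x c K (block_partition x B) (block_assignment B)"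
    unfolding solution_def by blast
  have "makespan (set js) a c (block_assignment B) \<le> 2"
  proof (cases "c = 0")
    \<comment> \<open>Without cores both makespans are the same value \<open>Max {}\<close>, so the
      bound 1 of the given solution carries over.\<close>
    case True
    then show ?thesis
      using ms by (simp add: makespan_def)
  next
    case False
    have "core_load (set js) a (block_assignment B) i \<le> 2" if "i \<in> {1..c}" for i
    proof -
      have "sum_list (map a b) \<le> 2" if "b \<in> set B" for b
        using that a_le set_zs by (intro fill_cores_load_le[of a "[]" zs]) (auto simp: B_def)
      \<comment> \<open>Cores beyond \<open>length B\<close> have load 0, so only used cores need
        the block bound.\<close>
      moreover have "B ! (i - 1) \<in> set B" if "i \<le> length B"
        using that \<open>i \<in> {1..c}\<close> by (intro nth_mem) auto
      ultimately show ?thesis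
        using core_load_block_assignment[of B i a] that dist by (simp add: concat_B set_zs del: set_concat)
    qed
    then show ?thesis
      using False unfolding makespan_def by (subst Max_le_iff) auto
  qed
  then show ?thesis
    using A2 sol' by blast
qed

end
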